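(* Let $G$ be a graph with at least one vertex, and let $|G|$ denote its number of vertices. Then $$\tilde\nu\text{-rank}(G)\le\left(\frac{|G|}{\alpha(G)}+1\right)^{\alpha(G)}.$$
   Context: $\mathbb N=\{0,1,2,\dots\}$; graphs are finite and simple; $\alpha(G)$ is the maximum size of a stable (independent) set of $G$. $\mathcal S^n$ is the space of real symmetric $n\times n$ matrices. For $\beta\in\mathbb N^n$ put $|\beta|=\sum_i\beta_i$ and $x^\beta=x_1^{\beta_1}\cdots x_n^{\beta_n}$. For $n,r\in\mathbb N$: $\mathcal N_{n,r}$ is the set of homogeneous polynomials of degree $r$ in $x_1,\dots,x_n$ with nonnegative coefficients (including $0$); $\mathcal H_{n,r}$ is the cone of homogeneous polynomials of degree $r+2$ (including $0$) of the form $\sum_{\beta\in\mathbb N^n,\ |\beta|\in\{r,r+2\}}x^\beta\sigma_\beta$, where each $\sigma_\beta$ is a sum of squares of real polynomials of degree at most $r+2-|\beta|$. $\|p\|_1$ is the sum of the absolute values of the coefficients of $p$. Define $$\widetilde{\mathcal Q}_n^{(r)}=\{M\in\mathcal S^n:\ p\cdot x^TMx\in\mathcal H_{n,r}\text{ for some }p\in\mathcal N_{n,r}\text{ with }\|p\|_1=1\}.$$ For a graph $G$ on $n$ vertices with adjacency matrix $A_G$, with $I$ the identity and $J$ the all-ones $n\times n$ matrix, $\tilde\nu^{(r)}(G)=\min\{t\in\mathbb R: t(A_G+I)-J\in\widetilde{\mathcal Q}_n^{(r)}\}$, and $\tilde\nu\text{-rank}(G)=\min\{r\in\mathbb N:\tilde\nu^{(r)}(G)=\alpha(G)\}$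 (equal to $+\infty$ if no such $r$ exists). *)

theory Defs
  imports "HOL-Analysis.Analysis" "HOL-Library.Poly_Mapping" "HOL-Library.Extended_Real"
begin

text \<open>
  A polynomial has one real variable for each element of the finite type \<open>'v\<close>: it maps exponent
  vectors in \<open>'v \<Rightarrow>\<^sub>0 nat\<close> to coefficients, and the product is convolution. Hence
  \<open>n = CARD('v)\<close>, and \<open>'v\<close> serves at once as index set of the variables and matrices and as vertex
  set of the graphs.
\<close>

type_synonym 'v exponent = "'v \<Rightarrow>\<^sub>0 nat"
type_synonym 'v mpoly = "'v exponent \<Rightarrow>\<^sub>0 real"

definition exp_sum :: "'v::finite exponent \<Rightarrow> nat" where
  "exp_sum \<beta> = (\<Sum>i\<in>UNIV. Poly_Mapping.lookup \<beta> i)"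

definition x_pow :: "'v exponent \<Rightarrow> 'v mpoly" where
  "x_pow \<beta> = Poly_Mapping.single \<beta> 1"

definition homogeneous :: "nat \<Rightarrow> 'v::finite mpoly \<Rightarrow> bool" where
  "homogeneous d p \<longleftrightarrow> (\<forall>\<beta>\<in>Poly_Mapping.keys p. exp_sum \<beta> = d)"

definition degree_at_most :: "nat \<Rightarrow> 'v::finite mpoly \<Rightarrow> bool" where
  "degree_at_most d p \<longleftrightarrow> (\<forall>\<beta>\<in>Poly_Mapping.keys p. exp_sum \<beta> \<le> d)"

definition coeff_norm1 :: "'v mpoly \<Rightarrow> real" where
  "coeff_norm1 p = (\<Sum>\<beta>\<in>Poly_Mapping.keys p. \<bar>Poly_Mapping.lookup p \<beta>\<bar>)"

text \<open>
  The degree bound applies to the polynomials being squared. In \<open>H_cone\<close> below, bounding the degree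
  of the whole sum of squares instead would give the same cone: the sum there is homogeneous of
  degree \<open>r + 2\<close>, and the leading forms of sums of squares, multiplied by monomials, cannot cancel
  because they are nonnegative on the positive orthant.
\<close>

definition sum_of_squares :: "nat \<Rightarrow> 'v::finite mpoly \<Rightarrow> bool" where
  "sum_of_squares d s \<longleftrightarrow>
     (\<exists>qs. (\<forall>q\<in>set qs. degree_at_most d q) \<and> s = (\<Sum>q\<leftarrow>qs. q ^ 2))"

definition N_cone :: "nat \<Rightarrow> 'v::finite mpoly set" where
  "N_cone r = {p. homogeneous r p \<and> (\<forall>\<beta>. Poly_Mapping.lookup p \<beta> \<ge> 0)}"

definition H_cone :: "nat \<Rightarrow> 'v::finite mpoly set" where
  "H_cone r = {f. homogeneous (r + 2) f \<and>
     (\<exists>\<sigma>. (\<forall>\<beta>. exp_sum \<beta> \<in> {r, r + 2} \<longrightarrow> sum_of_squares (r + 2 - exp_sum \<beta>) (\<sigma> \<beta>)) \<and>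
          f = (\<Sum>\<beta> | exp_sum \<beta> \<in> {r, r + 2}. x_pow \<beta> * \<sigma> \<beta>))}"

text \<open>The index set of the sum in \<open>H_cone\<close> is finite, so that sum is not the default value 0.\<close>

lemma finite_exp_sum: "finite {\<beta> :: 'v::finite exponent. exp_sum \<beta> \<in> {r, r + 2}}"
proof (rule finite_imageD)
  let ?E = "{\<beta> :: 'v exponent. exp_sum \<beta> \<in> {r, r + 2}}"
  have "Poly_Mapping.lookup \<beta> i \<le> r + 2" if "\<beta> \<in> ?E" for \<beta> i
  proof -
    have "Poly_Mapping.lookup \<beta> i \<le> exp_sum \<beta>"
      unfolding exp_sum_def by (rule member_le_sum) simp_all
    moreover have "exp_sum \<beta> \<le> r + 2" using that by force
    ultimately show ?thesis by (rule order_trans)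
  qed
  then have "Poly_Mapping.lookup ` ?E \<subseteq> PiE UNIV (\<lambda>_. {..r + 2})"
    unfolding PiE_UNIV_domain by blast
  then show "finite (Poly_Mapping.lookup ` ?E)"
    by (rule finite_subset) (simp add: finite_PiE)
  show "inj_on Poly_Mapping.lookup ?E"
    by (rule inj_onI) (simp only: lookup_inject)
qed

definition quad_form :: "real ^ 'v ^ 'v \<Rightarrow> 'v::finite mpoly" where
  "quad_form M = (\<Sum>i\<in>UNIV. \<Sum>j\<in>UNIV.
     Poly_Mapping.single (Poly_Mapping.single i 1 + Poly_Mapping.single j 1) (M $ i $ j))"

definition Q_tilde :: "nat \<Rightarrow> (real ^ 'v ^ 'v::finite) set" where
  "Q_tilde r = {M. transpose M = M \<and>
     (\<exists>p\<in>N_cone r. coeff_norm1 p = 1 \<and> p * quad_form M \<in> H_cone r)}"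

text \<open>A graph is given by its adjacency relation on the vertex set \<open>UNIV :: 'v set\<close>.\<close>

definition simple_graph :: "('v::finite \<Rightarrow> 'v \<Rightarrow> bool) \<Rightarrow> bool" where
  "simple_graph G \<longleftrightarrow> symp G \<and> irreflp G"

definition stable_set :: "('v::finite \<Rightarrow> 'v \<Rightarrow> bool) \<Rightarrow> 'v set \<Rightarrow> bool" where
  "stable_set G S \<longleftrightarrow> (\<forall>u\<in>S. \<forall>v\<in>S. \<not> G u v)"

definition stability_number :: "('v::finite \<Rightarrow> 'v \<Rightarrow> bool) \<Rightarrow> nat" where
  "stability_number G = Max {card S | S. stable_set G S}"

definition adjacency_matrix :: "('v::finite \<Rightarrow> 'v \<Rightarrow> bool) \<Rightarrow> real ^ 'v ^ 'v" where
  "adjacency_matrix G = (\<chi> i j. if G i j then 1 else 0)"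

definition all_ones :: "real ^ 'v ^ 'v::finite" where
  "all_ones = (\<chi> i j. 1)"

text \<open>
  The minimum in \<open>nu_tilde\<close> exists for every \<open>r\<close>: the admissible \<open>t\<close> form a nonempty closed set, bounded
  below by 1 since the matrices in \<open>Q_tilde r\<close> are copositive.
\<close>

definition nu_tilde :: "nat \<Rightarrow> ('v::finite \<Rightarrow> 'v \<Rightarrow> bool) \<Rightarrow> real" where
  "nu_tilde r G = (LEAST t. t *\<^sub>R (adjacency_matrix G + mat 1) - all_ones \<in> Q_tilde r)"

definition nu_tilde_rank :: "('v::finite \<Rightarrow> 'v \<Rightarrow> bool) \<Rightarrow> enat" where
  "nu_tilde_rank G =
     (if \<exists>r. nu_tilde r G = real (stability_number G)
      then enat (LEAST r. nu_tilde r G = real (stability_number G))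
      else \<infinity>)"

end

theory Submission
  imports Defs
begin

text \<open>
  Write \<open>\<alpha>\<close> for the stability number, \<open>N i\<close> for the closed neighbourhood of \<open>i\<close>, and \<open>x U\<close> for the sum
  of the variables in a vertex set \<open>U\<close>. The quadratic form of \<open>\<alpha> (A + I) - J\<close> is \<open>\<alpha> X - (x V)\<^sup>2\<close>, where
  \<open>X\<close> is the sum of \<open>x i * x j\<close> over the ordered pairs of equal or adjacent vertices. The proof finds a
  multiplier whose degree is at most the number of stable sets and then bounds that number.
  
  Why the form is nonnegative on the orthant, in a way that yields a certificate: build a stable set
  greedily, drawing a vertex \<open>i\<close> of the current set \<open>U\<close> with probability \<open>x i / x U\<close> and continuing with
  \<open>U - N i\<close>. Each run splits the vertex set into at most \<open>\<alpha>\<close> deleted parts, so by the Cauchy-Schwarz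
  inequality \<open>\<alpha>\<close> times the sum of the squared weights of the parts is at least \<open>(x V)\<^sup>2\<close>, and the
  difference is a sum of squares of linear forms. On the other hand \<open>X\<close> is at least the expected sum
  of the squared weights; this is lemma \<open>closed_nbhd_identity\<close>, applied step by step, where the excess
  has nonnegative coefficients. The only denominators are the \<open>x U\<close> for the sets \<open>U\<close> that occur in the
  process. These are the complements of the closed neighbourhoods of stable sets, so clearing
  denominators takes at most one linear factor for every stable set. The induction in
  \<open>prod_mult_defect_in_square_cone\<close> carries this out with the denominators already cleared, the
  Cauchy-Schwarz inequality being spread over the steps as \<open>square_completion\<close>.
  
  Hence \<open>\<alpha>\<close> is feasible at some level \<open>r\<close> that is at most the number of stable sets. No smaller value
  is feasible at any level, since matrices in \<open>Q_tilde r\<close> are copositive and the indicator vector of a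
  maximum stable set can be inserted (\<open>Q_tilde_feasible_ge_stability_number\<close>). Finally
  \<open>stable_weight_le\<close> bounds the number of stable sets by \<open>(n / \<alpha> + 1) ^ \<alpha>\<close> by shifting weights in the
  independence polynomial until its support is a stable set.
\<close>

section \<open>Counting stable sets\<close>

lemma stable_set_subset: "stable_set G S \<Longrightarrow> T \<subseteq> S \<Longrightarrow> stable_set G T"
  unfolding stable_set_def by blast

text \<open>
  The independence polynomial of the graph induced on \<open>U\<close>, with a separate weight for each vertex.
  The bound below concerns its value at the all-ones weight, which is the number of stable sets; the
  weights are what allows mass to be moved between vertices.
\<close>
definition stable_weight :: "('v::finite \<Rightarrow> 'v \<Rightarrow> bool) \<Rightarrow> ('v \<Rightarrow> real) \<Rightarrow> 'v set \<Rightarrow> real" where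
  "stable_weight G x U = (\<Sum>S | S \<subseteq> U \<and> stable_set G S. \<Prod>i\<in>S. x i)"

text \<open>
  The coefficient of \<open>x v\<close> in \<open>stable_weight G x (insert v U)\<close>, for \<open>v \<notin> U\<close>.
\<close>
definition link_weight :: "('v::finite \<Rightarrow> 'v \<Rightarrow> bool) \<Rightarrow> ('v \<Rightarrow> real) \<Rightarrow> 'v set \<Rightarrow> 'v \<Rightarrow> real" where
  "link_weight G x U v = (\<Sum>S | S \<subseteq> U \<and> stable_set G (insert v S). \<Prod>i\<in>S. x i)"

lemma stable_weight_insert:
  assumes "v \<notin> U"
  shows "stable_weight G x (insert v U) = stable_weight G x U + x v * link_weight G x U v"
proof -
  let ?L = "{S. S \<subseteq> U \<and> stable_set G (insert v S)}"
  have split: "{S. S \<subseteq> insert v U \<and> stable_set G S} = {S. S \<subseteq> U \<and> stable_set G S} \<union> insert v ` ?L"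
  proof (intro equalityI subsetI)
    fix S assume S: "S \<in> {S. S \<subseteq> insert v U \<and> stable_set G S}"
    show "S \<in> {S. S \<subseteq> U \<and> stable_set G S} \<union> insert v ` ?L"
    proof (cases "v \<in> S")
      case True
      then have "S - {v} \<in> ?L" using S by (auto simp: insert_absorb)
      moreover have "S = insert v (S - {v})" using True by blast
      ultimately show ?thesis by blast
    qed (use S in auto)
  qed (auto intro: stable_set_subset)
  have inj: "inj_on (insert v) ?L"
    using assms by (intro inj_onI) (metis (no_types, lifting) in_mono insert_ident mem_Collect_eq)
  have "stable_weight G x (insert v U)
      = stable_weight G x U + (\<Sum>S\<in>insert v ` ?L. \<Prod>i\<in>S. x i)"
    unfolding stable_weight_def split using assms by (intro sum.union_disjoint) auto
  also have "(\<Sum>S\<in>insert v ` ?L. \<Prod>i\<in>S. x i) = (\<Sum>S\<in>?L. x v * (\<Prod>i\<in>S. x i))"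
    unfolding sum.reindex[OF inj] using assms
    by (intro sum.cong refl) (auto intro!: prod.insert)
  also have "\<dots> = x v * link_weight G x U v"
    by (simp add: link_weight_def sum_distrib_left)
  finally show ?thesis .
qed

lemma link_weight_adjacent:
  assumes "G i j"
  shows "link_weight G x (insert i U) j = link_weight G x (U - {i}) j"
  unfolding link_weight_def
  using assms by (intro sum.cong refl) (auto simp: stable_set_def)

text \<open>
  This is the inequality of arithmetic and geometric means, applied to the factors \<open>1 + x i\<close> padded
  with ones to a list of length \<open>a\<close>: the padding replaces \<open>card U\<close> by its upper bound \<open>a\<close> on the
  right-hand side.
\<close>
lemma prod_one_plus_le:
  fixes x :: "'a \<Rightarrow> real"
  assumes "finite U" and nonneg: "\<And>i. i \<in> U \<Longrightarrow> 0 \<le> x i" and "card U \<le> a" and "0 < a"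
  shows "(\<Prod>i\<in>U. 1 + x i) \<le> (1 + sum x U / a) ^ a"
proof -
  obtain f where f: "bij_betw f {..<card U} U"
    using ex_bij_betw_nat_finite[OF \<open>finite U\<close>] by (auto simp: atLeast0LessThan)
  define y where "y k = (if k < card U then 1 + x (f k) else 1)" for k
  have set: "{..<a} = {..<card U} \<union> {card U..<a}" "{..<card U} \<inter> {card U..<a} = {}"
    using \<open>card U \<le> a\<close> by auto
  have fU: "f k \<in> U" if "k < card U" for k
    using f that by (auto simp: bij_betw_def)
  have y0: "0 \<le> y k" for k
    unfolding y_def using nonneg[OF fU[of k]] by auto
  have "(\<Prod>k<a. y k) = (\<Prod>k<card U. 1 + x (f k))"
    unfolding set(1) by (subst prod.union_disjoint) (auto simp: y_def)
  also have "\<dots> = (\<Prod>i\<in>U. 1 + x i)"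
    by (rule prod.reindex_bij_betw[OF f])
  finally have prod: "(\<Prod>k<a. y k) = (\<Prod>i\<in>U. 1 + x i)" .
  have "(\<Sum>k<card U. 1 + x (f k)) = (\<Sum>i\<in>U. 1 + x i)"
    by (rule sum.reindex_bij_betw[OF f])
  then have "(\<Sum>k<a. y k) = card U + sum x U + (a - card U)"
    unfolding set(1) by (subst sum.union_disjoint) (auto simp: y_def sum.distrib)
  then have sum: "(\<Sum>k<a. y k / card {..<a}) = 1 + sum x U / a"
    using assms by (simp add: sum_divide_distrib[symmetric] field_simps of_nat_diff)
  have le: "(\<Prod>k<a. y k) powr (1 / a) \<le> 1 + sum x U / a"
    using arith_geom_mean[of "{..<a}" y] y0 \<open>0 < a\<close> unfolding sum by auto
  have "0 \<le> (\<Prod>k<a. y k)" using y0 by (intro prod_nonneg) auto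
  then have "(\<Prod>k<a. y k) = ((\<Prod>k<a. y k) powr (1 / a)) ^ a"
    using \<open>0 < a\<close> powr_power[of "\<Prod>k<a. y k" "1 / real a" a]
    by (cases "(\<Prod>k<a. y k) = 0") (simp_all del: prod_zero_iff)
  also have "\<dots> \<le> (1 + sum x U / a) ^ a"
    using le by (intro power_mono) auto
  finally show ?thesis unfolding prod .
qed

text \<open>
  A weight-shifting argument in the style of Motzkin and Straus. If \<open>i\<close> and \<open>j\<close> are adjacent, no
  stable set contains both, so the independence polynomial is affine in \<open>(x i, x j)\<close> without mixed
  term. Moving the whole weight of one of them to the other, namely to the one with the larger
  coefficient, does not decrease the polynomial; it keeps the total weight and removes a vertex. Once
  the support is stable, the polynomial is \<open>\<Prod>i\<in>U. 1 + x i\<close> and the arithmetic-geometric mean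
  inequality applies.
\<close>
lemma stable_weight_le:
  assumes G: "simple_graph G" and "\<And>i. i \<in> U \<Longrightarrow> 0 \<le> x i"
    and "\<And>S. S \<subseteq> U \<Longrightarrow> stable_set G S \<Longrightarrow> card S \<le> a" and "0 < a"
  shows "stable_weight G x U \<le> (1 + sum x U / a) ^ a"
  using assms(2,3)
proof (induction "card U" arbitrary: U x rule: less_induct)
  case less
  note nonneg = less.prems(1) and bound = less.prems(2)
  show ?case
  proof (cases "stable_set G U")
    case True
    then have "{S. S \<subseteq> U \<and> stable_set G S} = Pow U" using stable_set_subset by auto
    then have "stable_weight G x U = (\<Prod>i\<in>U. 1 + x i)"
      using prod_add[of U x "\<lambda>_. 1"] by (simp add: stable_weight_def add.commute)
    then show ?thesis
      using prod_one_plus_le[of U x a] nonneg bound True \<open>0 < a\<close> by auto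
  next
    case False
    let ?B = "\<lambda>i j v. link_weight G x (U - {i, j}) v"
    \<comment> \<open>The orientation of the edge is chosen so that \<open>i\<close> is the vertex that receives the weight.\<close>
    obtain i j where ij: "i \<in> U" "j \<in> U" "G i j" "?B i j j \<le> ?B i j i"
    proof -
      obtain u v where uv: "u \<in> U" "v \<in> U" "G u v" "G v u"
        using False G unfolding stable_set_def simple_graph_def symp_def by blast
      show thesis
      proof (cases "?B u v v \<le> ?B u v u")
        case False
        then show ?thesis using that[of v u] uv by (simp add: insert_commute)
      qed (use that uv in blast)
    qed
    have "i \<noteq> j" using ij G unfolding simple_graph_def irreflp_def by metis
    let ?R = "U - {i, j}" and ?x = "x(i := x i + x j)"
    have U: "U = insert j (insert i ?R)" "U - {j} = insert i ?R" using ij \<open>i \<noteq> j\<close> by auto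
    have "stable_weight G x U = stable_weight G x (insert i ?R) + x j * link_weight G x (insert i ?R) j"
      using \<open>i \<noteq> j\<close> by (subst U(1), subst stable_weight_insert) auto
    also have "link_weight G x (insert i ?R) j = link_weight G x ?R j"
      using link_weight_adjacent[of G i j x ?R] \<open>G i j\<close> by simp
    also have "stable_weight G x (insert i ?R) = stable_weight G x ?R + x i * link_weight G x ?R i"
      by (rule stable_weight_insert) simp
    finally have "stable_weight G x U \<le> stable_weight G x ?R + (x i + x j) * link_weight G x ?R i"
      using mult_left_mono[OF ij(4), of "x j"] nonneg[OF ij(2)] by (simp add: algebra_simps)
    also have "\<dots> = stable_weight G ?x ?R + ?x i * link_weight G ?x ?R i"
      unfolding stable_weight_def link_weight_def
      by (intro arg_cong2[where f = "(+)"] arg_cong2[where f = "(*)"] sum.cong prod.cong refl) auto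
    also have "\<dots> = stable_weight G ?x (U - {j})"
      unfolding U(2) by (rule stable_weight_insert[symmetric]) simp
    also have "\<dots> \<le> (1 + sum ?x (U - {j}) / a) ^ a"
    proof (rule less.hyps)
      show "card (U - {j}) < card U" using ij by (intro psubset_card_mono) auto
    qed (use nonneg bound ij in auto)
    also have "sum ?x (U - {j}) = sum x U"
    proof -
      have "sum ?x ?R = sum x ?R" by (intro sum.cong) auto
      then have "sum ?x (U - {j}) = x i + x j + sum x ?R"
        unfolding U(2) by simp
      also have "\<dots> = sum x U"
        using \<open>i \<noteq> j\<close> by (subst (2) U(1)) simp
      finally show ?thesis .
    qed
    finally show ?thesis .
  qed
qed

lemma card_stable_le_stability_number: "stable_set G S \<Longrightarrow> card S \<le> stability_number G"
  unfolding stability_number_def by (intro Max_ge) auto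

lemma maximum_stable_set:
  obtains S where "stable_set G S" "card S = stability_number G"
proof -
  have "{} \<in> {S. stable_set G S}" by (simp add: stable_set_def)
  then have "stability_number G \<in> {card S | S. stable_set G S}"
    unfolding stability_number_def by (intro Max_in) auto
  then show thesis using that by auto
qed

lemma stability_number_pos:
  assumes "simple_graph G"
  shows "0 < stability_number G"
proof -
  have "stable_set G {undefined}"
    using assms by (auto simp: stable_set_def simple_graph_def irreflp_def)
  from card_stable_le_stability_number[OF this] show ?thesis by simp
qed

lemma card_stable_sets_le:
  assumes "simple_graph (G :: 'v::finite \<Rightarrow> 'v \<Rightarrow> bool)"
  shows "real (card {S. stable_set G S})
    \<le> (real CARD('v) / stability_number G + 1) ^ stability_number G"
  using stable_weight_le[OF assms, of UNIV "\<lambda>_. 1", OF _ card_stable_le_stability_number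
      stability_number_pos[OF assms]]
  by (simp add: stable_weight_def add.commute)

section \<open>Polynomials with nonnegative coefficients and the cone of certificates\<close>

lemma lookup_mult_nonneg:
  fixes p q :: "'v mpoly"
  assumes "\<And>\<beta>. 0 \<le> Poly_Mapping.lookup p \<beta>" "\<And>\<beta>. 0 \<le> Poly_Mapping.lookup q \<beta>"
  shows "0 \<le> Poly_Mapping.lookup (p * q) \<beta>"
  unfolding lookup_mult Sum_any.expand_set
  by (intro sum_nonneg mult_nonneg_nonneg) (auto simp: assms when_def)

lemma exp_sum_add: "exp_sum (\<beta> + \<gamma>) = exp_sum \<beta> + exp_sum \<gamma>"
  by (simp add: exp_sum_def lookup_add sum.distrib)

lemma exp_sum_zero [simp]: "exp_sum 0 = 0"
  by (simp add: exp_sum_def)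

lemma exp_sum_single [simp]: "exp_sum (Poly_Mapping.single i d) = d"
  by (simp add: exp_sum_def lookup_single when_def)

lemma homogeneous_zero [simp]: "homogeneous d 0"
  by (simp add: homogeneous_def)

lemma homogeneous_single: "exp_sum \<beta> = d \<Longrightarrow> homogeneous d (Poly_Mapping.single \<beta> c)"
  by (simp add: homogeneous_def)

lemma homogeneous_add: "homogeneous d p \<Longrightarrow> homogeneous d q \<Longrightarrow> homogeneous d (p + q)"
  unfolding homogeneous_def using keys_add[of p q] by blast

lemma homogeneous_uminus: "homogeneous d (p :: 'v::finite mpoly) \<Longrightarrow> homogeneous d (- p)"
  by (simp add: homogeneous_def in_keys_iff)

lemma homogeneous_diff:
  "homogeneous d p \<Longrightarrow> homogeneous d q \<Longrightarrow> homogeneous d (p - q :: 'v::finite mpoly)"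
  using homogeneous_add[OF _ homogeneous_uminus, of d p q] by simp

lemma homogeneous_mult: "homogeneous d p \<Longrightarrow> homogeneous e q \<Longrightarrow> homogeneous (d + e) (p * q)"
  unfolding homogeneous_def using keys_mult[of p q] by (fastforce simp: exp_sum_add)

lemma N_coneI: "homogeneous r p \<Longrightarrow> (\<And>\<beta>. 0 \<le> Poly_Mapping.lookup p \<beta>) \<Longrightarrow> p \<in> N_cone r"
  by (simp add: N_cone_def)

lemma N_cone_zero [simp]: "0 \<in> N_cone r"
  by (simp add: N_cone_def)

lemma N_cone_single: "0 \<le> c \<Longrightarrow> exp_sum \<beta> = r \<Longrightarrow> Poly_Mapping.single \<beta> c \<in> N_cone r"
  by (auto intro!: N_coneI homogeneous_single simp: lookup_single when_def)

lemma N_cone_add: "p \<in> N_cone r \<Longrightarrow> q \<in> N_cone r \<Longrightarrow> p + q \<in> N_cone r"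
  by (auto simp: N_cone_def lookup_add intro: homogeneous_add)

lemma N_cone_mult: "p \<in> N_cone r \<Longrightarrow> q \<in> N_cone s \<Longrightarrow> p * q \<in> N_cone (r + s)"
  by (auto simp: N_cone_def intro: homogeneous_mult lookup_mult_nonneg)

lemma N_cone_one: "1 \<in> N_cone 0"
  using N_cone_single[of 1 0 0] by simp

lemma N_cone_sum: "(\<And>i. i \<in> A \<Longrightarrow> f i \<in> N_cone r) \<Longrightarrow> (\<Sum>i\<in>A. f i) \<in> N_cone r"
  by (induction A rule: infinite_finite_induct) (auto intro: N_cone_add)

lemma N_cone_prod: "(\<And>i. i \<in> A \<Longrightarrow> f i \<in> N_cone 1) \<Longrightarrow> (\<Prod>i\<in>A. f i) \<in> N_cone (card A)"
proof (induction A rule: infinite_finite_induct)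
  case (insert a A)
  then show ?case using N_cone_mult[of "f a" 1 "prod f A" "card A"] by simp
qed (auto simp: N_cone_one)

lemma poly_mapping_eq_sum_single:
  fixes p :: "'a \<Rightarrow>\<^sub>0 'b::comm_monoid_add"
  assumes "finite A" "Poly_Mapping.keys p \<subseteq> A"
  shows "p = (\<Sum>\<beta>\<in>A. Poly_Mapping.single \<beta> (Poly_Mapping.lookup p \<beta>))"
proof (rule poly_mapping_eqI)
  fix \<gamma>
  have "Poly_Mapping.lookup p \<gamma> = (if \<gamma> \<in> A then Poly_Mapping.lookup p \<gamma> else 0)"
    using assms(2) by (auto simp: in_keys_iff)
  also have "\<dots> = (\<Sum>\<beta>\<in>A. if \<gamma> = \<beta> then Poly_Mapping.lookup p \<beta> else 0)"
    using assms(1) by simp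
  also have "\<dots> = Poly_Mapping.lookup (\<Sum>\<beta>\<in>A. Poly_Mapping.single \<beta> (Poly_Mapping.lookup p \<beta>)) \<gamma>"
    unfolding lookup_sum by (intro sum.cong) (auto simp: lookup_single when_def)
  finally show "Poly_Mapping.lookup p \<gamma>
    = Poly_Mapping.lookup (\<Sum>\<beta>\<in>A. Poly_Mapping.single \<beta> (Poly_Mapping.lookup p \<beta>)) \<gamma>" .
qed

text \<open>
  The part of \<open>H_cone r\<close> that the certificate uses: here the squares are those of linear forms only
  and the monomials with a common square are collected in one multiplier. In this form, closure under
  multiplication by polynomials with nonnegative coefficients is immediate, whereas in the
  presentation of \<open>H_cone\<close> the sum would have to be reindexed by new exponent vectors.
\<close>
inductive_set square_cone :: "nat \<Rightarrow> 'v::finite mpoly set" for r where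
  nonneg: "p \<in> N_cone (r + 2) \<Longrightarrow> p \<in> square_cone r"
| square: "p \<in> N_cone r \<Longrightarrow> homogeneous 1 q \<Longrightarrow> p * q\<^sup>2 \<in> square_cone r"
| add: "f \<in> square_cone r \<Longrightarrow> g \<in> square_cone r \<Longrightarrow> f + g \<in> square_cone r"

lemma square_cone_zero [simp]: "0 \<in> square_cone r"
  by (rule square_cone.nonneg) simp

lemma square_cone_sum: "(\<And>i. i \<in> A \<Longrightarrow> f i \<in> square_cone r) \<Longrightarrow> (\<Sum>i\<in>A. f i) \<in> square_cone r"
  by (induction A rule: infinite_finite_induct) (auto intro: square_cone.add)

lemma square_cone_mult:
  assumes "f \<in> square_cone r" "p \<in> N_cone s"
  shows "p * f \<in> square_cone (s + r)"
  using assms(1)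
proof induction
  case (nonneg q)
  from N_cone_mult[OF assms(2) this] show ?case
    by (intro square_cone.nonneg) (simp add: add.assoc)
next
  case (square q l)
  from square_cone.square[OF N_cone_mult[OF assms(2) this(1)] this(2)] show ?case
    by (simp add: mult.assoc)
next
  case (add f g)
  then show ?case by (simp add: distrib_left square_cone.add)
qed

lemma sum_of_squares_zero: "sum_of_squares d 0"
  unfolding sum_of_squares_def by (rule exI[of _ "[]"]) simp

lemma sum_of_squares_square: "degree_at_most d q \<Longrightarrow> sum_of_squares d (q\<^sup>2)"
  unfolding sum_of_squares_def by (rule exI[of _ "[q]"]) simp

lemma sum_of_squares_add:
  "sum_of_squares d s \<Longrightarrow> sum_of_squares d t \<Longrightarrow> sum_of_squares d (s + t)"
  unfolding sum_of_squares_def by clarsimp (metis Un_iff map_append set_append sum_list_append)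

lemma H_cone_add:
  assumes "f \<in> H_cone r" "g \<in> H_cone r"
  shows "f + g \<in> H_cone r"
proof -
  let ?E = "{\<beta> :: 'a exponent. exp_sum \<beta> \<in> {r, r + 2}}"
  from assms obtain \<sigma> \<tau> where
    "\<forall>\<beta>. exp_sum \<beta> \<in> {r, r + 2} \<longrightarrow> sum_of_squares (r + 2 - exp_sum \<beta>) (\<sigma> \<beta>)"
    "f = (\<Sum>\<beta>\<in>?E. x_pow \<beta> * \<sigma> \<beta>)"
    "\<forall>\<beta>. exp_sum \<beta> \<in> {r, r + 2} \<longrightarrow> sum_of_squares (r + 2 - exp_sum \<beta>) (\<tau> \<beta>)"
    "g = (\<Sum>\<beta>\<in>?E. x_pow \<beta> * \<tau> \<beta>)"
    unfolding H_cone_def by blast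
  then show ?thesis
    using assms unfolding H_cone_def
    by (auto intro!: homogeneous_add exI[of _ "\<lambda>\<beta>. \<sigma> \<beta> + \<tau> \<beta>"]
        simp: sum_of_squares_add distrib_left sum.distrib)
qed

text \<open>
  Splitting \<open>p\<close> into its monomials gives the presentation of \<open>H_cone\<close>, because the nonnegative
  coefficient \<open>c\<close> of a monomial can be absorbed into the square: \<open>c * q\<^sup>2 = (sqrt c * q)\<^sup>2\<close>. The degree
  \<open>d\<close> of \<open>p\<close> is a parameter so that the lemma covers both ranges of exponents in \<open>H_cone\<close>:
  \<open>d = r\<close> with a linear \<open>q\<close>, and \<open>d = r + 2\<close> with \<open>q = 1\<close>.
\<close>
lemma H_cone_mult_square:
  assumes p: "p \<in> N_cone d" and d: "d \<in> {r, r + 2}" and q: "homogeneous (r + 2 - d) (q\<^sup>2)"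
    and deg: "\<And>c. degree_at_most (r + 2 - d) (Poly_Mapping.single 0 c * q)"
  shows "p * q\<^sup>2 \<in> H_cone r"
proof -
  let ?E = "{\<beta> :: 'a exponent. exp_sum \<beta> \<in> {r, r + 2}}"
  let ?c = "Poly_Mapping.lookup p"
  define \<sigma> where "\<sigma> \<beta> = (if exp_sum \<beta> = d then (Poly_Mapping.single 0 (sqrt (?c \<beta>)) * q)\<^sup>2 else 0)" for \<beta>
  have keys: "Poly_Mapping.keys p \<subseteq> ?E"
    using p d by (auto simp: N_cone_def homogeneous_def)
  have "p * q\<^sup>2 = (\<Sum>\<beta>\<in>?E. Poly_Mapping.single \<beta> (?c \<beta>) * q\<^sup>2)"
    by (subst poly_mapping_eq_sum_single[OF finite_exp_sum keys]) (simp add: sum_distrib_right)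
  also have "\<dots> = (\<Sum>\<beta>\<in>?E. x_pow \<beta> * \<sigma> \<beta>)"
  proof (intro sum.cong refl)
    fix \<beta> :: "'a exponent"
    show "Poly_Mapping.single \<beta> (?c \<beta>) * q\<^sup>2 = x_pow \<beta> * \<sigma> \<beta>"
    proof (cases "exp_sum \<beta> = d")
      case True
      have "0 \<le> ?c \<beta>" using p by (simp add: N_cone_def)
      then have "x_pow \<beta> * (Poly_Mapping.single 0 (sqrt (?c \<beta>)))\<^sup>2 = Poly_Mapping.single \<beta> (?c \<beta>)"
        by (simp add: x_pow_def power2_eq_square mult_single)
      then show ?thesis by (simp add: \<sigma>_def True power_mult_distrib mult.assoc[symmetric])
    next
      case False
      then have "?c \<beta> = 0" using p by (auto simp: N_cone_def homogeneous_def in_keys_iff)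
      then show ?thesis by (simp add: \<sigma>_def False)
    qed
  qed
  finally have "p * q\<^sup>2 = (\<Sum>\<beta>\<in>?E. x_pow \<beta> * \<sigma> \<beta>)" .
  moreover have "homogeneous (r + 2) (p * q\<^sup>2)"
    using homogeneous_mult[of d p "r + 2 - d" "q\<^sup>2"] p q d by (auto simp: N_cone_def)
  moreover have "sum_of_squares (r + 2 - exp_sum \<beta>) (\<sigma> \<beta>)" for \<beta>
    by (cases "exp_sum \<beta> = d")
      (simp_all add: \<sigma>_def sum_of_squares_zero sum_of_squares_square deg del: add_2_eq_Suc')
  ultimately show ?thesis unfolding H_cone_def by blast
qed

lemma square_cone_subset_H_cone: "square_cone r \<subseteq> (H_cone r :: 'v::finite mpoly set)"
proof
  fix f :: "'v mpoly" assume "f \<in> square_cone r"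
  then show "f \<in> H_cone r"
  proof induction
    case (nonneg p)
    then have "p * 1\<^sup>2 \<in> H_cone r"
      by (rule H_cone_mult_square) (auto simp: homogeneous_def degree_at_most_def)
    then show ?case by simp
  next
    case (square p q)
    have "homogeneous 2 (q\<^sup>2)"
      using homogeneous_mult[OF square(2) square(2)] by (simp add: power2_eq_square numeral_2_eq_2)
    moreover have "homogeneous 1 (Poly_Mapping.single 0 c * q)" for c
      using homogeneous_mult[of 0 "Poly_Mapping.single 0 c" 1 q] square(2)
      by (simp add: homogeneous_single)
    ultimately show ?case
      using square(1) by (intro H_cone_mult_square) (auto simp: homogeneous_def degree_at_most_def)
  next
    case (add f g)
    then show ?case by (rule_tac H_cone_add)
  qed
qed

section \<open>Evaluation of polynomials\<close>

definition eval_poly :: "('v::finite \<Rightarrow> real) \<Rightarrow> 'v mpoly \<Rightarrow> real" where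
  "eval_poly x p = (\<Sum>\<beta>\<in>Poly_Mapping.keys p.
     Poly_Mapping.lookup p \<beta> * (\<Prod>i\<in>UNIV. x i ^ Poly_Mapping.lookup \<beta> i))"

lemma eval_poly_zero [simp]: "eval_poly x 0 = 0"
  by (simp add: eval_poly_def)

lemma eval_poly_single:
  "eval_poly x (Poly_Mapping.single \<beta> c) = c * (\<Prod>i\<in>UNIV. x i ^ Poly_Mapping.lookup \<beta> i)"
  by (simp add: eval_poly_def)

lemma eval_poly_one [simp]: "eval_poly x 1 = 1"
  using eval_poly_single[of x 0 1] by simp

lemma eval_poly_add: "eval_poly x (p + q) = eval_poly x p + eval_poly x q"
  unfolding eval_poly_def by (rule setsum_keys_plus_distrib) (simp_all add: distrib_right)

lemma eval_poly_sum: "eval_poly x (\<Sum>i\<in>A. f i) = (\<Sum>i\<in>A. eval_poly x (f i))"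
  by (induction A rule: infinite_finite_induct) (auto simp: eval_poly_add)

lemma eval_poly_mult: "eval_poly x (p * q) = eval_poly x p * eval_poly x q"
proof -
  let ?s = "\<lambda>p \<beta>. Poly_Mapping.single \<beta> (Poly_Mapping.lookup p \<beta>)"
  have expand: "r = (\<Sum>\<beta>\<in>Poly_Mapping.keys r. ?s r \<beta>)" for r :: "'a mpoly"
    by (rule poly_mapping_eq_sum_single) auto
  have "eval_poly x (p * q)
      = (\<Sum>\<beta>\<in>Poly_Mapping.keys p. \<Sum>\<gamma>\<in>Poly_Mapping.keys q. eval_poly x (?s p \<beta> * ?s q \<gamma>))"
    by (subst expand[of p], subst expand[of q]) (simp add: sum_product eval_poly_sum)
  also have "\<dots> = (\<Sum>\<beta>\<in>Poly_Mapping.keys p. \<Sum>\<gamma>\<in>Poly_Mapping.keys q.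
      eval_poly x (?s p \<beta>) * eval_poly x (?s q \<gamma>))"
    by (simp add: mult_single eval_poly_single lookup_add power_add prod.distrib mult_ac)
  also have "\<dots> = eval_poly x p * eval_poly x q"
    by (subst (3) expand[of p], subst (3) expand[of q]) (simp add: sum_product eval_poly_sum)
  finally show ?thesis .
qed

lemma eval_poly_prod: "eval_poly x (\<Prod>i\<in>A. f i) = (\<Prod>i\<in>A. eval_poly x (f i))"
  by (induction A rule: infinite_finite_induct) (auto simp: eval_poly_mult)

lemma sum_of_squares_eval_nonneg:
  assumes "sum_of_squares d s"
  shows "0 \<le> eval_poly x s"
proof -
  obtain qs where "s = (\<Sum>q\<leftarrow>qs. q\<^sup>2)" using assms unfolding sum_of_squares_def by blast
  then show ?thesis
    by (induction qs arbitrary: s) (auto simp: eval_poly_add eval_poly_mult power2_eq_square)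
qed

lemma H_cone_eval_nonneg:
  assumes "f \<in> H_cone r" and "\<And>i. 0 \<le> x i"
  shows "0 \<le> eval_poly x f"
proof -
  obtain \<sigma> where "\<forall>\<beta>. exp_sum \<beta> \<in> {r, r + 2} \<longrightarrow> sum_of_squares (r + 2 - exp_sum \<beta>) (\<sigma> \<beta>)"
    "f = (\<Sum>\<beta> | exp_sum \<beta> \<in> {r, r + 2}. x_pow \<beta> * \<sigma> \<beta>)"
    using assms(1) unfolding H_cone_def by blast
  then show ?thesis
    by (auto simp: eval_poly_sum eval_poly_mult x_pow_def eval_poly_single assms(2)
        intro!: sum_nonneg mult_nonneg_nonneg prod_nonneg zero_le_power
        intro: sum_of_squares_eval_nonneg)
qed

lemma coeff_norm1_eq_eval: "p \<in> N_cone r \<Longrightarrow> coeff_norm1 p = eval_poly (\<lambda>_. 1) p"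
  by (simp add: coeff_norm1_def eval_poly_def N_cone_def)

lemma N_cone_eval_pos:
  assumes "p \<in> N_cone r" and "coeff_norm1 p = 1" and "\<And>i. 0 < x i"
  shows "0 < eval_poly x p"
proof -
  have "Poly_Mapping.keys p \<noteq> {}" using assms(2) by (auto simp: coeff_norm1_def)
  moreover have "0 < Poly_Mapping.lookup p \<beta>" if "\<beta> \<in> Poly_Mapping.keys p" for \<beta>
    using that assms(1) by (auto simp: N_cone_def in_keys_iff less_le)
  ultimately show ?thesis
    unfolding eval_poly_def using assms(3) by (intro sum_pos) (auto intro!: mult_pos_pos prod_pos)
qed

definition var :: "'v \<Rightarrow> 'v mpoly" where
  "var i = Poly_Mapping.single (Poly_Mapping.single i 1) 1"

abbreviation const :: "real \<Rightarrow> 'v mpoly" where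
  "const c \<equiv> Poly_Mapping.single 0 c"

lemma eval_poly_var: "eval_poly x (var i) = x i"
proof -
  have "(\<Prod>j\<in>UNIV. x j ^ Poly_Mapping.lookup (Poly_Mapping.single i 1) j)
      = (\<Prod>j\<in>UNIV. if j = i then x j else 1)"
    by (intro prod.cong refl) (auto simp: lookup_single when_def)
  then show ?thesis by (simp add: var_def eval_poly_single del: One_nat_def)
qed

lemma eval_poly_const: "eval_poly x (const c) = c"
  by (simp add: eval_poly_single)

lemma quad_form_eq:
  "quad_form M = (\<Sum>i\<in>UNIV. \<Sum>j\<in>UNIV. const (M $ i $ j) * var i * var j)"
  unfolding quad_form_def var_def by (simp add: mult_single)

section \<open>The stability number as a lower bound\<close>

text \<open>
  Strict positivity of the point is essential for dividing by the value of the multiplier \<open>p\<close>, which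
  may vanish on the boundary of the orthant.
\<close>
lemma Q_tilde_copositive:
  assumes "M \<in> Q_tilde r" and "\<And>i. 0 < x i"
  shows "0 \<le> (\<Sum>i\<in>UNIV. \<Sum>j\<in>UNIV. M $ i $ j * x i * x j)"
proof -
  obtain p where p: "p \<in> N_cone r" "coeff_norm1 p = 1" "p * quad_form M \<in> H_cone r"
    using assms(1) unfolding Q_tilde_def by blast
  have "0 \<le> eval_poly x p * eval_poly x (quad_form M)"
    using H_cone_eval_nonneg[OF p(3), of x] assms(2) by (simp add: eval_poly_mult less_imp_le)
  then have "0 \<le> eval_poly x (quad_form M)"
    using N_cone_eval_pos[OF p(1,2), of x] assms(2) by (simp add: zero_le_mult_iff)
  then show ?thesis
    by (simp add: quad_form_eq eval_poly_sum eval_poly_mult eval_poly_var eval_poly_const)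
qed

text \<open>
  At the indicator vector of a maximum stable set, of size \<open>\<alpha>\<close>, the quadratic form has the value
  \<open>\<alpha> * (t - \<alpha>)\<close>. This point lies on the boundary of the orthant, so it is approached along
  \<open>indicator + e\<close> for positive \<open>e\<close> tending to 0.
\<close>
lemma Q_tilde_feasible_ge_stability_number:
  assumes G: "simple_graph G" and Q: "t *\<^sub>R (adjacency_matrix G + mat 1) - all_ones \<in> Q_tilde r"
  shows "real (stability_number G) \<le> t"
proof -
  obtain S where S: "stable_set G S" "card S = stability_number G"
    by (rule maximum_stable_set)
  define M where "M = t *\<^sub>R (adjacency_matrix G + mat 1) - all_ones"
  define f where "f e = (\<Sum>i\<in>UNIV. \<Sum>j\<in>UNIV.
      M $ i $ j * (of_bool (i \<in> S) + e) * (of_bool (j \<in> S) + e))" for e :: real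
  have "0 \<le> f e" if "0 < e" for e
    unfolding f_def by (rule Q_tilde_copositive[OF Q[folded M_def]]) (use that in auto)
  then have "\<forall>\<^sub>F e in at_right 0. 0 \<le> f e"
    unfolding eventually_at_right_field by (intro exI[of _ 1]) auto
  moreover have "(f \<longlongrightarrow> f 0) (at_right 0)"
    unfolding f_def by (intro tendsto_intros)
  ultimately have "0 \<le> f 0"
    by (intro tendsto_lowerbound[of f "f 0" "at_right 0"]) auto
  also have "f 0 = (\<Sum>i\<in>S. \<Sum>j\<in>S. M $ i $ j)"
  proof -
    have "f 0 = (\<Sum>i\<in>UNIV. \<Sum>j\<in>S. M $ i $ j * of_bool (i \<in> S))"
      unfolding f_def by (intro sum.cong refl sum.mono_neutral_cong_right) auto
    also have "\<dots> = (\<Sum>i\<in>S. \<Sum>j\<in>S. M $ i $ j)"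
      by (intro sum.mono_neutral_cong_right) auto
    finally show ?thesis .
  qed
  also have "\<dots> = (\<Sum>i\<in>S. \<Sum>j\<in>S. (if i = j then t else 0) - 1)"
  proof (intro sum.cong refl)
    fix i j assume "i \<in> S" "j \<in> S"
    then have "\<not> G i j" using S(1) by (auto simp: stable_set_def)
    then show "M $ i $ j = (if i = j then t else 0) - 1"
      by (simp add: M_def adjacency_matrix_def all_ones_def mat_def)
  qed
  also have "\<dots> = real (card S) * (t - real (card S))"
    by (simp add: sum_subtractf algebra_simps)
  finally show ?thesis
    using stability_number_pos[OF G] by (simp add: S zero_le_mult_iff)
qed

section \<open>The recursion for the quadratic form\<close>

text \<open>
  The algebraic core. Take for \<open>a\<close> the 0/1 indicator of closed neighbourhoods \<open>N i\<close>. Then the factors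
  \<open>1 - a i j\<close> select the vertices outside \<open>N i\<close>, so that the inner double sum on the right is the same
  quadratic form on what is left after deleting \<open>N i\<close>, and the square is that of the deleted weight
  \<open>x (N i)\<close>. In probabilistic terms, a vertex \<open>i\<close> is drawn with probability proportional to \<open>x i\<close> and
  \<open>N i\<close> is deleted; the identity says that the quadratic form is at least the expected value of the
  remaining form plus the square of the deleted weight. The excess has nonnegative coefficients: it
  counts the pairs of vertices in \<open>N i\<close> that are neither equal nor adjacent. For the proof, both sides
  are triple sums over \<open>U\<close> of \<open>x i * x j * x l\<close>; the coefficients differ by terms
  \<open>a i j * a j l\<close>, \<open>a i l * a j l\<close> and \<open>a i j * a i l\<close>, and these have equal sums since each
  describes the two-step walks, only with a different name for the middle vertex.
\<close>
lemma closed_nbhd_identity: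
  fixes x :: "'a \<Rightarrow> 'b::comm_ring_1"
  assumes sym: "\<And>i j. a i j = a j i"
  shows "(\<Sum>i\<in>U. x i) * (\<Sum>j\<in>U. \<Sum>l\<in>U. a j l * x j * x l)
    = (\<Sum>i\<in>U. x i * ((\<Sum>j\<in>U. \<Sum>l\<in>U. (1 - a i j) * (1 - a i l) * a j l * x j * x l)
                     + (\<Sum>j\<in>U. a i j * x j)\<^sup>2))
      + (\<Sum>i\<in>U. \<Sum>j\<in>U. \<Sum>l\<in>U. a i j * a i l * (1 - a j l) * x i * x j * x l)"
proof -
  define T where "T f = (\<Sum>i\<in>U. \<Sum>j\<in>U. \<Sum>l\<in>U. f i j l * x i * x j * x l)" for f
  have cong: "T f = T g" if "\<And>i j l. f i j l = g i j l" for f g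
    using that by (simp add: T_def)
  have add: "T f + T g = T (\<lambda>i j l. f i j l + g i j l)" for f g
    by (simp add: T_def sum.distrib distrib_right)
  have swap12: "T f = T (\<lambda>i j l. f j i l)" for f
    unfolding T_def by (subst sum.swap) (simp add: mult_ac)
  have swap23: "T f = T (\<lambda>i j l. f i l j)" for f
    unfolding T_def by (rule sum.cong[OF refl], subst sum.swap) (simp add: mult_ac)
  have left: "(\<Sum>i\<in>U. x i) * (\<Sum>j\<in>U. \<Sum>l\<in>U. a j l * x j * x l) = T (\<lambda>i j l. a j l)"
    unfolding T_def sum_distrib_right by (simp add: sum_distrib_left mult_ac)
  have right: "(\<Sum>i\<in>U. x i * ((\<Sum>j\<in>U. \<Sum>l\<in>U. (1 - a i j) * (1 - a i l) * a j l * x j * x l)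
        + (\<Sum>j\<in>U. a i j * x j)\<^sup>2))
      = T (\<lambda>i j l. (1 - a i j) * (1 - a i l) * a j l + a i j * a i l)"
    unfolding add[symmetric] unfolding T_def power2_eq_square sum_product distrib_left sum.distrib
    by (simp add: sum_distrib_left mult_ac)
  have Y: "T (\<lambda>i j l. a i j * a j l) = T (\<lambda>i j l. a i j * a i l)"
    by (subst swap12) (simp add: sym)
  have Y': "T (\<lambda>i j l. a i l * a j l) = T (\<lambda>i j l. a i j * a i l)"
    unfolding Y[symmetric] by (subst swap23) (rule cong, simp add: sym)
  have "T (\<lambda>i j l. a j l) + (T (\<lambda>i j l. a i j * a i l) + T (\<lambda>i j l. a i j * a i l))
      = T (\<lambda>i j l. (1 - a i j) * (1 - a i l) * a j l + a i j * a i l)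
        + T (\<lambda>i j l. a i j * a i l * (1 - a j l))
        + (T (\<lambda>i j l. a i j * a j l) + T (\<lambda>i j l. a i l * a j l))"
    unfolding add by (rule cong) (simp add: algebra_simps)
  then show ?thesis
    unfolding left right Y Y' by (simp add: T_def)
qed

lemma var_in_N_cone: "var i \<in> N_cone 1"
  unfolding var_def by (rule N_cone_single) simp_all

lemma const_in_N_cone: "0 \<le> c \<Longrightarrow> const c \<in> N_cone 0"
  by (rule N_cone_single) simp_all

lemma of_nat_in_N_cone: "of_nat k \<in> N_cone 0"
  using const_in_N_cone[of "real k"] by simp

definition var_sum :: "'v::finite set \<Rightarrow> 'v mpoly" where
  "var_sum U = (\<Sum>i\<in>U. var i)"

definition closed_nbhd :: "('v \<Rightarrow> 'v \<Rightarrow> bool) \<Rightarrow> 'v \<Rightarrow> 'v set" where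
  "closed_nbhd G i = {j. i = j \<or> G i j}"

definition edge_form :: "('v::finite \<Rightarrow> 'v \<Rightarrow> bool) \<Rightarrow> 'v set \<Rightarrow> 'v mpoly" where
  "edge_form G U = (\<Sum>i\<in>U. \<Sum>j\<in>U. of_bool (j \<in> closed_nbhd G i) * var i * var j)"

text \<open>
  With \<open>k = \<alpha>(G)\<close> and \<open>U = UNIV\<close> this is the quadratic form of \<open>\<alpha>(G) (A + I) - J\<close>; the general \<open>k\<close> and
  \<open>U\<close> serve the induction on the graph.
\<close>
definition defect :: "('v::finite \<Rightarrow> 'v \<Rightarrow> bool) \<Rightarrow> nat \<Rightarrow> 'v set \<Rightarrow> 'v mpoly" where
  "defect G k U = of_nat k * edge_form G U - (var_sum U)\<^sup>2"

lemma var_sum_in_N_cone: "var_sum U \<in> N_cone 1"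
  unfolding var_sum_def by (intro N_cone_sum var_in_N_cone)

lemma homogeneous_var_sum: "homogeneous 1 (var_sum U)"
  using var_sum_in_N_cone[of U] by (simp add: N_cone_def)

lemma homogeneous_of_nat_mult: "homogeneous d p \<Longrightarrow> homogeneous d (of_nat k * p)"
  using homogeneous_mult[of 0 "of_nat k" d p] of_nat_in_N_cone[of k] by (auto simp: N_cone_def)

lemma var_sum_mult_edge_form:
  fixes G :: "'v::finite \<Rightarrow> 'v \<Rightarrow> bool"
  assumes "simple_graph G"
  obtains R where "R \<in> N_cone 3"
    and "var_sum U * edge_form G U = (\<Sum>i\<in>U. var i *
      (edge_form G (U - closed_nbhd G i) + (var_sum (U \<inter> closed_nbhd G i))\<^sup>2)) + R"
proof
  define a :: "'v \<Rightarrow> 'v \<Rightarrow> 'v mpoly" where "a i j = of_bool (j \<in> closed_nbhd G i)" for i j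
  let ?R = "\<Sum>i\<in>U. \<Sum>j\<in>U. \<Sum>l\<in>U. a i j * a i l * (1 - a j l) * var i * var j * var l"
  have sym: "a i j = a j i" for i j
    using assms by (auto simp: a_def closed_nbhd_def simple_graph_def symp_def)
  have "a i j * a i l * (1 - a j l) * var i * var j * var l \<in> N_cone 3" for i j l
  proof -
    have "var i * var j * var l \<in> N_cone (1 + 1 + 1)"
      by (intro N_cone_mult var_in_N_cone)
    then show ?thesis by (simp add: a_def mult.assoc numeral_3_eq_3)
  qed
  then show "?R \<in> N_cone 3" by (intro N_cone_sum)
  have edge: "edge_form G (U - closed_nbhd G i)
      = (\<Sum>j\<in>U. \<Sum>l\<in>U. (1 - a i j) * (1 - a i l) * a j l * var j * var l)" for i
  proof -
    have "(\<Sum>j\<in>U. \<Sum>l\<in>U. (1 - a i j) * (1 - a i l) * a j l * var j * var l)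
        = (\<Sum>j\<in>U. if j \<notin> closed_nbhd G i
             then (\<Sum>l\<in>U. if l \<notin> closed_nbhd G i then a j l * var j * var l else 0) else 0)"
      by (intro sum.cong refl) (auto simp: a_def intro!: sum.cong sum.neutral)
    also have "\<dots> = edge_form G (U - closed_nbhd G i)"
      unfolding edge_form_def a_def[symmetric]
      by (simp add: sum.If_cases set_diff_eq Int_def)
    finally show ?thesis ..
  qed
  have lin: "var_sum (U \<inter> closed_nbhd G i) = (\<Sum>j\<in>U. a i j * var j)" for i
    unfolding var_sum_def by (rule sum.mono_neutral_cong_left) (auto simp: a_def)
  show "var_sum U * edge_form G U = (\<Sum>i\<in>U. var i *
      (edge_form G (U - closed_nbhd G i) + (var_sum (U \<inter> closed_nbhd G i))\<^sup>2)) + ?R"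
    unfolding edge lin unfolding var_sum_def edge_form_def a_def[symmetric]
    by (rule closed_nbhd_identity[OF sym])
qed

text \<open>
  In the recursion, \<open>s\<close> is the weight of the remaining vertices, \<open>b\<close> that of the deleted ones and \<open>X\<close>
  the form on the remaining vertices. The identity converts the bound \<open>k * X \<ge> s\<^sup>2\<close> on the remaining
  graph into the bound for \<open>Suc k\<close> on the whole, at the cost of one square of a linear form. It is
  multiplied by \<open>k\<close> to avoid division in the ring.
\<close>
lemma square_completion:
  fixes X b s :: "'a::comm_ring_1"
  shows "of_nat k * (of_nat (Suc k) * (X + b\<^sup>2) - (s + b)\<^sup>2)
    = of_nat (Suc k) * (of_nat k * X - s\<^sup>2) + (s - of_nat k * b)\<^sup>2"
  by (simp add: algebra_simps power2_eq_square)

definition nonempty_members_below :: "'v set set \<Rightarrow> 'v set \<Rightarrow> 'v set set" where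
  "nonempty_members_below F U = {W \<in> F. W \<subseteq> U \<and> W \<noteq> {}}"

text \<open>
  Induction on \<open>U\<close>. The factor \<open>var_sum U\<close> of the multiplier is used up by the recursion on \<open>U\<close>
  and turns into variables \<open>var i\<close>. The remaining factors contain those needed for each of the smaller
  sets \<open>U - closed_nbhd G i\<close>, as these belong to \<open>F\<close> and are proper subsets of \<open>U\<close>; the factors
  that are left over have nonnegative coefficients and do no harm. Deleting a closed neighbourhood
  lowers the largest size of a stable set, because \<open>i\<close> can be added to any stable set of the rest.
\<close>
lemma prod_mult_defect_in_square_cone:
  fixes G :: "'v::finite \<Rightarrow> 'v \<Rightarrow> bool"
  assumes G: "simple_graph G"
    and F: "\<And>U i. U \<in> F \<Longrightarrow> i \<in> U \<Longrightarrow> U - closed_nbhd G i \<in> F"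
    and "U \<in> F" and "\<And>S. S \<subseteq> U \<Longrightarrow> stable_set G S \<Longrightarrow> card S \<le> k"
  shows "(\<Prod>W\<in>nonempty_members_below F U. var_sum W) * defect G k U \<in> square_cone (card (nonempty_members_below F U))"
  using assms(3,4)
proof (induction "card U" arbitrary: U k rule: less_induct)
  case less
  let ?N = "closed_nbhd G"
  show ?case
  proof (cases "U = {}")
    case True
    then show ?thesis by (simp add: defect_def edge_form_def var_sum_def)
  next
    case False
    then obtain v where "v \<in> U" by blast
    have "stable_set G {v}" using G by (auto simp: stable_set_def simple_graph_def irreflp_def)
    then have "k \<noteq> 0" using less.prems(2)[of "{v}"] \<open>v \<in> U\<close> by auto
    then obtain k' where k: "k = Suc k'" by (cases k) auto
    let ?L = "nonempty_members_below F U"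
    define D where "D = (\<Prod>W\<in>?L - {U}. var_sum W)"
    define d where "d = card (?L - {U})"
    have U: "U \<in> ?L" using less.prems(1) False by (simp add: nonempty_members_below_def)
    have DU: "(\<Prod>W\<in>?L. var_sum W) = var_sum U * D"
      unfolding D_def using U by (simp add: prod.remove)
    have card: "card ?L = Suc d"
      unfolding d_def using card_Suc_Diff1[OF _ U] by simp
    have D: "D \<in> N_cone d"
      unfolding D_def d_def by (intro N_cone_prod var_sum_in_N_cone)
    obtain R where R: "R \<in> N_cone 3" and identity:
      "var_sum U * edge_form G U = (\<Sum>i\<in>U. var i *
        (edge_form G (U - ?N i) + (var_sum (U \<inter> ?N i))\<^sup>2)) + R"
      by (rule var_sum_mult_edge_form[OF G])
    \<comment> \<open>The summand for the choice of \<open>i\<close>, expressed by the remaining set and the deleted weight.\<close>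
    define g where "g i = of_nat k * (edge_form G (U - ?N i) + (var_sum (U \<inter> ?N i))\<^sup>2)
      - (var_sum U)\<^sup>2" for i
    have "var_sum U * defect G k U
        = of_nat k * (var_sum U * edge_form G U) - var_sum U * (var_sum U)\<^sup>2"
      by (simp add: defect_def algebra_simps)
    also have "\<dots> = (\<Sum>i\<in>U. var i * g i) + of_nat k * R"
      unfolding identity g_def right_diff_distrib sum_subtractf
      by (simp add: var_sum_def[of U] sum_distrib_right sum_distrib_left distrib_left mult_ac)
    finally have "(\<Prod>W\<in>?L. var_sum W) * defect G k U
        = (\<Sum>i\<in>U. D * var i * g i) + of_nat k * (D * R)"
      unfolding DU by (simp add: distrib_left sum_distrib_left mult_ac)
    moreover have "of_nat k * (D * R) \<in> square_cone (Suc d)"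
    proof (rule square_cone.nonneg)
      have "of_nat k * (D * R) \<in> N_cone (0 + (d + 3))"
        by (intro N_cone_mult of_nat_in_N_cone D R)
      then show "of_nat k * (D * R) \<in> N_cone (Suc d + 2)" by (simp add: eval_nat_numeral)
    qed
    moreover have "D * var i * g i \<in> square_cone (Suc d)" if "i \<in> U" for i
    proof -
      let ?V = "U - ?N i"
      define s b where "s = var_sum ?V" and "b = var_sum (U \<inter> ?N i)"
      have split: "var_sum U = s + b"
        unfolding s_def b_def var_sum_def
        by (subst sum.union_disjoint[symmetric]) (auto intro: arg_cong2[where f = sum])
      have "i \<in> ?N i" by (simp add: closed_nbhd_def)
      have bound: "card S \<le> k'" if "S \<subseteq> ?V" "stable_set G S" for S
      proof -
        have "stable_set G (insert i S)"
          using that G \<open>i \<in> U\<close> unfolding stable_set_def closed_nbhd_def simple_graph_def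
          by (auto simp: irreflp_def symp_def)
        moreover have "i \<notin> S" using that \<open>i \<in> ?N i\<close> by auto
        ultimately show ?thesis
          using less.prems(2)[of "insert i S"] that \<open>i \<in> U\<close> k by auto
      qed
      show ?thesis
      proof (cases "k' = 0")
        case True
        \<comment> \<open>Division by \<open>k'\<close> is impossible here, but then \<open>i\<close> dominates \<open>U\<close> and the summand vanishes.\<close>
        have "?V = {}"
        proof (rule ccontr)
          assume "?V \<noteq> {}"
          then obtain w where "w \<in> ?V" by blast
          moreover have "stable_set G {w}"
            using G by (auto simp: stable_set_def simple_graph_def irreflp_def)
          ultimately show False using bound[of "{w}"] True by auto
        qed
        then have "g i = 0"
          unfolding g_def split s_def b_def \<open>?V = {}\<close>
            by (simp add: k True edge_form_def var_sum_def)
        then show ?thesis by simp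
      next
        case False
        let ?M = "nonempty_members_below F ?V"
        let ?P = "\<Prod>W\<in>?M. var_sum W"
        define E where "E = (\<Prod>W\<in>?L - {U} - ?M. var_sum W)"
        have sub: "?M \<subseteq> ?L - {U}"
          using \<open>i \<in> U\<close> \<open>i \<in> ?N i\<close> by (auto simp: nonempty_members_below_def)
        have DE: "D = E * ?P"
          unfolding D_def E_def by (rule prod.subset_diff[OF sub]) simp
        have d: "d = card (?L - {U} - ?M) + card ?M"
          unfolding d_def using card_Diff_subset[OF _ sub] card_mono[OF _ sub] by simp
        have E: "E \<in> N_cone (card (?L - {U} - ?M))"
          unfolding E_def by (intro N_cone_prod var_sum_in_N_cone)
        have IH: "?P * defect G k' ?V \<in> square_cone (card ?M)"
        proof (rule less.hyps)
          show "card ?V < card U"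
            using \<open>i \<in> U\<close> \<open>i \<in> ?N i\<close> by (intro psubset_card_mono) auto
        qed (use bound F less.prems(1) \<open>i \<in> U\<close> in auto)
        have "of_nat k * (var i * E) * (?P * defect G k' ?V) \<in> square_cone (0 + (1 + card (?L - {U} - ?M)) + card ?M)"
          by (intro square_cone_mult IH N_cone_mult of_nat_in_N_cone var_in_N_cone E)
        then have "of_nat k * (D * var i) * defect G k' ?V \<in> square_cone (Suc d)"
          by (simp add: DE d mult_ac)
        moreover have "(D * var i) * (s - of_nat k' * b)\<^sup>2 \<in> square_cone (d + 1)"
          unfolding s_def b_def
          by (intro square_cone.square N_cone_mult D var_in_N_cone homogeneous_diff
              homogeneous_of_nat_mult homogeneous_var_sum)
        ultimately have "of_nat k * (D * var i) * defect G k' ?V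
            + (D * var i) * (s - of_nat k' * b)\<^sup>2 \<in> square_cone (Suc d)"
          by (simp add: square_cone.add)
        also have "of_nat k * (D * var i) * defect G k' ?V + (D * var i) * (s - of_nat k' * b)\<^sup>2
            = (D * var i) * (of_nat k' * g i)"
          unfolding g_def split k b_def[symmetric] square_completion
          by (simp add: defect_def s_def algebra_simps)
        finally have "const (1 / real k') * ((D * var i) * (of_nat k' * g i)) \<in> square_cone (0 + Suc d)"
          by (intro square_cone_mult const_in_N_cone) simp_all
        also have "const (1 / real k') * ((D * var i) * (of_nat k' * g i))
            = (const (1 / real k') * const (real k')) * (D * var i * g i)"
          by (simp add: mult_ac)
        also have "const (1 / real k') * const (real k') = (1 :: 'v mpoly)"
          unfolding mult_single using False by simp
        finally show ?thesis by simp
      qed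
    qed
    ultimately show ?thesis
      unfolding card by (auto intro!: square_cone.add square_cone_sum)
  qed
qed

lemma quad_form_eq_defect:
  fixes G :: "'v::finite \<Rightarrow> 'v \<Rightarrow> bool"
  assumes "simple_graph G"
  shows "quad_form (real k *\<^sub>R (adjacency_matrix G + mat 1) - all_ones) = defect G k UNIV"
proof -
  have coeff: "const ((real k *\<^sub>R (adjacency_matrix G + mat 1) - all_ones) $ i $ j)
      = of_nat k * of_bool (j \<in> closed_nbhd G i) - (1 :: 'v mpoly)" for i j
    using assms
    by (auto simp: adjacency_matrix_def mat_def all_ones_def closed_nbhd_def
        simple_graph_def irreflp_def single_diff)
  then show ?thesis
    unfolding quad_form_eq coeff defect_def edge_form_def var_sum_def power2_eq_square sum_product
    by (simp add: sum_distrib_left sum_subtractf algebra_simps)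
qed

section \<open>The multiplier built from all stable sets\<close>

text \<open>
  The vertex sets that remain when a stable set is built up vertex by vertex and closed neighbourhoods
  are deleted. The set is a function of the stable set chosen so far and does not depend on the order
  of the choices, hence there are at most as many of these sets as there are stable sets.
\<close>
definition residual_sets :: "('v::finite \<Rightarrow> 'v \<Rightarrow> bool) \<Rightarrow> 'v set set" where
  "residual_sets G = (\<lambda>S. - (\<Union>i\<in>S. closed_nbhd G i)) ` {S. stable_set G S}"

lemma residual_sets_remove:
  assumes G: "simple_graph G" and "U \<in> residual_sets G" and "i \<in> U"
  shows "U - closed_nbhd G i \<in> residual_sets G"
proof -
  obtain S where S: "stable_set G S" "U = - (\<Union>i\<in>S. closed_nbhd G i)"
    using assms(2) by (auto simp: residual_sets_def)
  have "stable_set G (insert i S)"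
    using S assms(3) G unfolding stable_set_def closed_nbhd_def simple_graph_def
    by (auto simp: irreflp_def symp_def)
  moreover have "U - closed_nbhd G i = - (\<Union>i\<in>insert i S. closed_nbhd G i)"
    using S(2) by auto
  ultimately show ?thesis unfolding residual_sets_def by blast
qed

text \<open>
  The multiplier is the product of the linear forms \<open>var_sum W\<close> over all nonempty residual sets \<open>W\<close>,
  divided by the sum \<open>c\<close> of its coefficients, which is its value at the all-ones point.
\<close>
lemma Q_tilde_feasible_at_stability_number:
  fixes G :: "'v::finite \<Rightarrow> 'v \<Rightarrow> bool"
  assumes G: "simple_graph G"
  obtains r where "r \<le> card {S. stable_set G S}"
    and "real (stability_number G) *\<^sub>R (adjacency_matrix G + mat 1) - all_ones \<in> Q_tilde r"
proof
  let ?L = "nonempty_members_below (residual_sets G) UNIV"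
  let ?M = "real (stability_number G) *\<^sub>R (adjacency_matrix G + mat 1) - all_ones :: real^'v^'v"
  define D where "D = (\<Prod>W\<in>?L. var_sum W :: 'v mpoly)"
  define c where "c = eval_poly (\<lambda>_. 1) D"
  have "card ?L \<le> card (residual_sets G)"
    by (intro card_mono) (auto simp: nonempty_members_below_def)
  also have "\<dots> \<le> card {S. stable_set G S}"
    unfolding residual_sets_def by (rule card_image_le) simp
  finally show "card ?L \<le> card {S. stable_set G S}" .
  have D: "D \<in> N_cone (card ?L)"
    unfolding D_def by (intro N_cone_prod var_sum_in_N_cone)
  have "0 < c"
    unfolding c_def D_def eval_poly_prod
    by (intro prod_pos) (auto simp: nonempty_members_below_def var_sum_def eval_poly_sum eval_poly_var card_gt_0_iff)
  have "UNIV \<in> residual_sets G"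
    unfolding residual_sets_def by (rule image_eqI[of _ _ "{}"]) (auto simp: stable_set_def)
  then have "D * defect G (stability_number G) UNIV \<in> square_cone (card ?L)"
    unfolding D_def
    by (intro prod_mult_defect_in_square_cone[OF G])
      (auto intro: residual_sets_remove[OF G] card_stable_le_stability_number)
  then have "const (1 / c) * (D * quad_form ?M) \<in> square_cone (0 + card ?L)"
    unfolding quad_form_eq_defect[OF G] using \<open>0 < c\<close>
    by (intro square_cone_mult const_in_N_cone) simp_all
  then have cone: "(const (1 / c) * D) * quad_form ?M \<in> H_cone (card ?L)"
    using square_cone_subset_H_cone by (auto simp: mult.assoc)
  have N: "const (1 / c) * D \<in> N_cone (card ?L)"
    using N_cone_mult[OF const_in_N_cone D, of "1 / c"] \<open>0 < c\<close> by simp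
  then have norm: "coeff_norm1 (const (1 / c) * D) = 1"
    using \<open>0 < c\<close> by (simp add: coeff_norm1_eq_eval eval_poly_mult eval_poly_const flip: c_def)
  have "transpose ?M = ?M"
    using G by (auto simp: transpose_def adjacency_matrix_def mat_def all_ones_def vec_eq_iff
        simple_graph_def symp_def)
  then show "?M \<in> Q_tilde (card ?L)"
    unfolding Q_tilde_def using N norm cone by blast
qed

section \<open>The rank bound\<close>

theorem corollary4p9:
  fixes G :: "'v::finite \<Rightarrow> 'v \<Rightarrow> bool"
  assumes "simple_graph G"
  shows "ereal_of_enat (nu_tilde_rank G) \<le>
    ereal ((real CARD('v) / real (stability_number G) + 1) ^ stability_number G)"
proof -
  obtain r where r: "r \<le> card {S. stable_set G S}"
    "real (stability_number G) *\<^sub>R (adjacency_matrix G + mat 1) - all_ones \<in> Q_tilde r"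
    by (rule Q_tilde_feasible_at_stability_number[OF assms])
  have "nu_tilde r G = real (stability_number G)"
    unfolding nu_tilde_def
    by (rule Least_equality) (use r(2) Q_tilde_feasible_ge_stability_number[OF assms] in auto)
  then have "nu_tilde_rank G \<le> enat r"
    unfolding nu_tilde_rank_def by (auto intro: Least_le)
  also have "\<dots> \<le> enat (card {S. stable_set G S})" using r(1) by simp
  finally have "ereal_of_enat (nu_tilde_rank G) \<le> ereal_of_enat (enat (card {S. stable_set G S}))"
    by (simp only: ereal_of_enat_le_iff)
  also have "\<dots> = ereal (card {S. stable_set G S})"
    by simp
  also have "\<dots> \<le> ereal ((real CARD('v) / real (stability_number G) + 1) ^ stability_number G)"
    using card_stable_sets_le[OF assms] by simp
  finally show ?thesis .
qed

end
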